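(* Let $\alpha\le\beta$ be positive integers and let $(E,w)$ be the weighted graph with vertices $u,s_1,s_2$ and exactly four edges: $e_1$ from $u$ to $s_1$ of weight $\alpha$, $e_2$ from $u$ to $s_2$ of weight $\beta$, $f_1$ from $s_1$ to $u$ of weight $1$, and $f_2$ from $s_2$ to $u$ of weight $1$. Then the weighted graph monoid $\mathcal M(E,w)$ is confluent if and only if $\alpha=1$ or $\beta-\alpha\le 1$.
   Context: $\mathbb N=\{1,2,\dots\}$. A directed graph is $E=(E^0,E^1,s,r)$ with vertex set $E^0$, edge set $E^1$ and source/range maps $s,r:E^1\to E^0$. A vertex $v$ is regular if $0<|s^{-1}(v)|<\infty$. A weighted graph $(E,w)$ is a directed graph $E$ with a map $w:E^1\to\mathbb N$. For $v\in E^0$ let $w_1(v)<\dots<w_{k_v}(v)$ be the distinct weights of the edges in $s^{-1}(v)$ (so $k_v=0$ for a sink), and put $w_0(v)=0$. Let $\mathcal E=\{v,q_1^v,\dots,q_{k_v-1}^v : v\in E^0\}$ (formal distinct symbols), let $F_{\mathcal E}$ be the free commutative monoid on $\mathcal E$, written additively, and set $q_0^v=q_{k_v}^v=0$ in $F_{\mathcal E}$. For regular $u$ and $\gamma\in w(s^{-1}(u))$ put $\Sigma_\gamma(u)=\sum_{e\in s^{-1}(u),\,w(e)=\gamma} r(e)\in F_{\mathcal E}$. Define the reduction relation $\to$ on $F_{\mathcal E}$ by $$y+q_{i-1}^u+(w_i(u)-w_{i-1}(u))u\ \to\ y+q_i^u+\Sigma_{w_i(u)}(u)$$ for all $y\in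 F_{\mathcal E}$, regular $u$ and $1\le i\le k_u$. Let $\to^*$ be its reflexive-transitive closure and $\sim$ the congruence it generates. The weighted graph monoid is $\mathcal M(E,w)=F_{\mathcal E}/\!\sim$. It is called confluent if for all $a,b\in F_{\mathcal E}$: $a\sim b$ if and only if there is $c\in F_{\mathcal E}$ with $a\to^* c$ and $b\to^* c$. *)

theory Defs
  imports "Graph_Theory.Digraph" "HOL-Library.Multiset"
begin

text \<open>
  The requirement that the set of weights at a vertex be finite is what makes
  the listing \<open>w_1(v) < \<dots> < w_{k_v}(v)\<close> meaningful at infinite emitters.
\<close>

locale weighted_digraph = wf_digraph G for G :: "('v, 'e) pre_digraph" +
  fixes w :: "'e \<Rightarrow> nat"
  assumes weight_pos: "e \<in> arcs G \<Longrightarrow> 1 \<le> w e"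
    and finite_weights: "v \<in> verts G \<Longrightarrow> finite (w ` out_arcs G v)"

definition regular_vertex :: "('v, 'e) pre_digraph \<Rightarrow> 'v \<Rightarrow> bool" where
  "regular_vertex G v \<longleftrightarrow> v \<in> verts G \<and> finite (out_arcs G v) \<and> out_arcs G v \<noteq> {}"

definition num_weights :: "('v, 'e) pre_digraph \<Rightarrow> ('e \<Rightarrow> nat) \<Rightarrow> 'v \<Rightarrow> nat" where
  "num_weights G w v = card (w ` out_arcs G v)"

text \<open>The \<open>i\<close>-th weight \<open>w_i(v)\<close>, with \<open>w_0(v) = 0\<close>; only used for \<open>i \<le> k_v\<close>.\<close>

definition ith_weight :: "('v, 'e) pre_digraph \<Rightarrow> ('e \<Rightarrow> nat) \<Rightarrow> 'v \<Rightarrow> nat \<Rightarrow> nat" where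
  "ith_weight G w v i = (0 # sorted_list_of_set (w ` out_arcs G v)) ! i"

datatype 'v generator = Vert 'v | Q 'v nat

definition generators :: "('v, 'e) pre_digraph \<Rightarrow> ('e \<Rightarrow> nat) \<Rightarrow> 'v generator set" where
  "generators G w = Vert ` verts G \<union>
     {Q v i | v i. v \<in> verts G \<and> 1 \<le> i \<and> i < num_weights G w v}"

text \<open>The free commutative monoid on the generators: finite multisets of generators.\<close>

definition free_monoid :: "('v, 'e) pre_digraph \<Rightarrow> ('e \<Rightarrow> nat) \<Rightarrow> 'v generator multiset set" where
  "free_monoid G w = {a. set_mset a \<subseteq> generators G w}"

definition q_elem :: "('v, 'e) pre_digraph \<Rightarrow> ('e \<Rightarrow> nat) \<Rightarrow> 'v \<Rightarrow> nat \<Rightarrow> 'v generator multiset" where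
  "q_elem G w v i = (if i = 0 \<or> i = num_weights G w v then {#} else {#Q v i#})"

definition range_sum :: "('v, 'e) pre_digraph \<Rightarrow> ('e \<Rightarrow> nat) \<Rightarrow> 'v \<Rightarrow> nat \<Rightarrow> 'v generator multiset" where
  "range_sum G w u \<gamma> = (\<Sum>e\<in>{e \<in> out_arcs G u. w e = \<gamma>}. {#Vert (head G e)#})"

inductive wg_red :: "('v, 'e) pre_digraph \<Rightarrow> ('e \<Rightarrow> nat)
    \<Rightarrow> 'v generator multiset \<Rightarrow> 'v generator multiset \<Rightarrow> bool"
  for G :: "('v, 'e) pre_digraph" and w :: "'e \<Rightarrow> nat" where
  "\<lbrakk>y \<in> free_monoid G w; regular_vertex G u; 1 \<le> i; i \<le> num_weights G w u\<rbrakk> \<Longrightarrow>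
    wg_red G w
      (y + q_elem G w u (i - 1)
         + replicate_mset (ith_weight G w u i - ith_weight G w u (i - 1)) (Vert u))
      (y + q_elem G w u i + range_sum G w u (ith_weight G w u i))"

text \<open>The congruence on the free commutative monoid generated by the reduction relation.\<close>

inductive wg_cong :: "('v, 'e) pre_digraph \<Rightarrow> ('e \<Rightarrow> nat)
    \<Rightarrow> 'v generator multiset \<Rightarrow> 'v generator multiset \<Rightarrow> bool"
  for G :: "('v, 'e) pre_digraph" and w :: "'e \<Rightarrow> nat" where
  red: "wg_red G w a b \<Longrightarrow> wg_cong G w a b"
| refl: "a \<in> free_monoid G w \<Longrightarrow> wg_cong G w a a"
| sym: "wg_cong G w a b \<Longrightarrow> wg_cong G w b a"
| trans: "wg_cong G w a b \<Longrightarrow> wg_cong G w b c \<Longrightarrow> wg_cong G w a c"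
| add: "wg_cong G w a b \<Longrightarrow> wg_cong G w c d \<Longrightarrow> wg_cong G w (a + c) (b + d)"

text \<open>
  Confluence of the weighted graph monoid, the quotient of the free commutative
  monoid by \<^const>\<open>wg_cong\<close>.  It is a property of the presentation, hence of
  the weighted graph, rather than of the abstract quotient monoid.
\<close>

definition wg_monoid_confluent :: "('v, 'e) pre_digraph \<Rightarrow> ('e \<Rightarrow> nat) \<Rightarrow> bool" where
  "wg_monoid_confluent G w \<longleftrightarrow>
     (\<forall>a\<in>free_monoid G w. \<forall>b\<in>free_monoid G w.
        wg_cong G w a b \<longleftrightarrow>
        (\<exists>c\<in>free_monoid G w. (wg_red G w)\<^sup>*\<^sup>* a c \<and> (wg_red G w)\<^sup>*\<^sup>* b c))"

datatype two_cycles_vertex = U | S1 | S2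

datatype two_cycles_edge = E1 | E2 | F1 | F2

fun two_cycles_src :: "two_cycles_edge \<Rightarrow> two_cycles_vertex" where
  "two_cycles_src E1 = U"
| "two_cycles_src E2 = U"
| "two_cycles_src F1 = S1"
| "two_cycles_src F2 = S2"

fun two_cycles_rng :: "two_cycles_edge \<Rightarrow> two_cycles_vertex" where
  "two_cycles_rng E1 = S1"
| "two_cycles_rng E2 = S2"
| "two_cycles_rng F1 = U"
| "two_cycles_rng F2 = U"

definition two_cycles_graph :: "(two_cycles_vertex, two_cycles_edge) pre_digraph" where
  "two_cycles_graph = \<lparr>verts = {U, S1, S2}, arcs = {E1, E2, F1, F2}, tail = two_cycles_src, head = two_cycles_rng\<rparr>"

fun two_cycles_weight :: "nat \<Rightarrow> nat \<Rightarrow> two_cycles_edge \<Rightarrow> nat" where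
  "two_cycles_weight \<alpha> \<beta> E1 = \<alpha>"
| "two_cycles_weight \<alpha> \<beta> E2 = \<beta>"
| "two_cycles_weight \<alpha> \<beta> F1 = 1"
| "two_cycles_weight \<alpha> \<beta> F2 = 1"

lemma weighted_digraph_two_cycles:
  assumes "1 \<le> \<alpha>" "1 \<le> \<beta>"
  shows "weighted_digraph two_cycles_graph (two_cycles_weight \<alpha> \<beta>)"
proof
  fix v
  have "finite (out_arcs two_cycles_graph v)"
    by (rule finite_subset[of _ "{E1, E2, F1, F2}"]) (auto simp: out_arcs_def two_cycles_graph_def)
  then show "finite (two_cycles_weight \<alpha> \<beta> ` out_arcs two_cycles_graph v)" by simp
qed (use assms in \<open>auto simp: two_cycles_graph_def\<close>)

end

theory Submission
  imports Defs
begin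

text \<open>
  The edges \<open>s\<^sub>1 \<rightarrow> u\<close> and \<open>s\<^sub>2 \<rightarrow> u\<close> of weight \<open>1\<close> turn each \<open>s\<^sub>i\<close> into \<open>u\<close>, and no other
  reduction consumes an \<open>s\<^sub>i\<close>.  So it is harmless to identify the three vertices and to keep of a
  monoid element only two numbers: how many vertices \<open>v\<close> and how many symbols \<open>q = q\<^sub>1\<close> of \<open>u\<close>
  it contains.  On such pairs the remaining reductions read, if \<open>\<alpha> < \<beta>\<close>,
  \<^item> \<open>(v, q) \<rightarrow> (v - \<alpha> + 1, q + 1)\<close> for \<open>\<alpha> \<le> v\<close>, and
  \<^item> \<open>(v, q) \<rightarrow> (v - (\<beta> - \<alpha>) + 1, q - 1)\<close> for \<open>\<beta> - \<alpha> \<le> v\<close> and \<open>1 \<le> q\<close>.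

  If \<open>\<alpha> = \<beta>\<close>, there is the single reduction \<open>(v, q) \<rightarrow> (v - \<alpha> + 2, q)\<close> for \<open>\<alpha> \<le> v\<close> instead.
  By \<open>confluent_if_count_invariant\<close>, confluence follows once a quantity preserved by these
  steps determines whether two pairs have a common reduct.

  If \<open>\<alpha> = 1 < \<beta>\<close>, the first reduction creates \<open>q\<close> for free and the second lowers \<open>v\<close> by
  \<open>\<beta> - 2\<close>.  If \<open>\<beta> = \<alpha> + 1\<close>, the second destroys \<open>q\<close> for free and the first lowers \<open>v\<close> by
  \<open>\<alpha> - 1 = \<beta> - 2\<close>.  Either way, as long as \<open>v \<noteq> 0\<close>, the count \<open>q\<close> can be changed at will in one
  direction, so only the residue of \<open>v\<close> modulo \<open>\<beta> - 2\<close> matters, and lowering \<open>v\<close> to the smallest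
  positive number in its residue class joins any two equivalent pairs.  If \<open>\<alpha> = \<beta> \<ge> 2\<close>, the same
  works with \<open>v \<ge> 2\<close> modulo \<open>\<alpha> - 2\<close>; if \<open>\<alpha> = \<beta> = 1\<close>, any positive \<open>v\<close> can be increased at will.

  If \<open>2 \<le> \<alpha>\<close> and \<open>2 \<le> \<beta> - \<alpha>\<close>, both reductions of \<open>u\<close> apply to \<open>q + max(\<alpha>, \<beta> - \<alpha>) u\<close>.  The
  first leaves two symbols \<open>q\<close> and too few vertices ever to consume one of them, the second leaves
  no \<open>q\<close> and too few vertices ever to produce one.  As no step increases \<open>v\<close>, the two results have
  no common reduct (\<open>not_confluent\<close>).
\<close>

section \<open>Reductions in an arbitrary weighted graph\<close>

lemma free_monoid_add [simp]:
  "a + b \<in> free_monoid G w \<longleftrightarrow> a \<in> free_monoid G w \<and> b \<in> free_monoid G w"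
  by (auto simp: free_monoid_def)

lemma free_monoid_empty [simp]: "{#} \<in> free_monoid G w"
  by (simp add: free_monoid_def)

lemma free_monoid_add_mset [simp]:
  "add_mset x a \<in> free_monoid G w \<longleftrightarrow> x \<in> generators G w \<and> a \<in> free_monoid G w"
  by (auto simp: free_monoid_def)

lemma free_monoid_replicate_mset [simp]:
  "replicate_mset n x \<in> free_monoid G w \<longleftrightarrow> n = 0 \<or> x \<in> generators G w"
  by (auto simp: free_monoid_def)

lemma wg_red_add_left:
  assumes "wg_red G w a b" and "c \<in> free_monoid G w"
  shows "wg_red G w (c + a) (c + b)"
  using assms
proof (induction rule: wg_red.induct)
  case (1 y u i)
  then show ?case
    using wg_red.intros[of "c + y" G w u i] by (simp add: add.assoc)
qed

lemma wg_reds_imp_wg_cong: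
  assumes "(wg_red G w)\<^sup>*\<^sup>* a b" and "a \<in> free_monoid G w"
  shows "wg_cong G w a b"
  using assms
  by (induction rule: rtranclp_induct) (auto intro: wg_cong.intros)

text \<open>
  The congruence also allows addition on both sides, which an invariant \<open>f\<close> need not respect.
  Since reductions are stable under adding a fixed element, the induction goes through for the
  translates \<open>y + a\<close> and \<open>y + b\<close> by all \<open>y\<close> at once.
\<close>

lemma wg_cong_invariant:
  assumes inv: "\<And>a b. wg_red G w a b \<Longrightarrow> f a = f b"
    and cong: "wg_cong G w a b"
    and mem: "\<And>a b. wg_red G w a b \<Longrightarrow> a \<in> free_monoid G w \<and> b \<in> free_monoid G w"
  shows "f a = f b"
proof -
  have "a \<in> free_monoid G w \<and> b \<in> free_monoid G w
      \<and> (\<forall>y\<in>free_monoid G w. f (y + a) = f (y + b))"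
    using cong
  proof (induction rule: wg_cong.induct)
    case (red a b)
    then show ?case using mem inv wg_red_add_left by metis
  next
    case (add a b c d)
    have "f (y + (a + c)) = f (y + (b + d))" if y: "y \<in> free_monoid G w" for y
    proof -
      have "f ((y + c) + a) = f ((y + c) + b)" "f ((y + b) + c) = f ((y + b) + d)"
        using add.IH y by auto
      then show ?thesis by (simp add: ac_simps)
    qed
    then show ?case using add.IH by auto
  qed auto
  then show ?thesis by (metis add_0 free_monoid_empty)
qed

section \<open>The reductions of the graph with two cycles\<close>

abbreviation tc_free :: "nat \<Rightarrow> nat \<Rightarrow> two_cycles_vertex generator multiset set" where
  "tc_free \<alpha> \<beta> \<equiv> free_monoid two_cycles_graph (two_cycles_weight \<alpha> \<beta>)"

abbreviation tc_red ::
  "nat \<Rightarrow> nat \<Rightarrow> two_cycles_vertex generator multiset \<Rightarrow> two_cycles_vertex generator multiset \<Rightarrow> bool"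
  where "tc_red \<alpha> \<beta> \<equiv> wg_red two_cycles_graph (two_cycles_weight \<alpha> \<beta>)"

lemma verts_two_cycles [simp]: "v \<in> verts two_cycles_graph"
  by (cases v) (auto simp: two_cycles_graph_def)

lemma head_two_cycles [simp]: "head two_cycles_graph = two_cycles_rng"
  by (simp add: two_cycles_graph_def)

lemma out_arcs_two_cycles [simp]:
  "out_arcs two_cycles_graph U = {E1, E2}"
  "out_arcs two_cycles_graph S1 = {F1}"
  "out_arcs two_cycles_graph S2 = {F2}"
  by (auto simp: out_arcs_def two_cycles_graph_def)

lemma regular_two_cycles [simp]: "regular_vertex two_cycles_graph v"
  by (cases v) (auto simp: regular_vertex_def)

lemma num_weights_two_cycles [simp]:
  "num_weights two_cycles_graph (two_cycles_weight \<alpha> \<beta>) U = (if \<alpha> = \<beta> then 1 else 2)"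
  "num_weights two_cycles_graph (two_cycles_weight \<alpha> \<beta>) S1 = 1"
  "num_weights two_cycles_graph (two_cycles_weight \<alpha> \<beta>) S2 = 1"
  by (auto simp: num_weights_def)

lemma ith_weight_0 [simp]: "ith_weight G w v 0 = 0"
  by (simp add: ith_weight_def)

lemma ith_weight_two_cycles:
  "\<alpha> \<le> \<beta> \<Longrightarrow> ith_weight two_cycles_graph (two_cycles_weight \<alpha> \<beta>) U (Suc 0) = \<alpha>"
  "\<alpha> < \<beta> \<Longrightarrow> ith_weight two_cycles_graph (two_cycles_weight \<alpha> \<beta>) U 2 = \<beta>"
  "ith_weight two_cycles_graph (two_cycles_weight \<alpha> \<beta>) S1 (Suc 0) = 1"
  "ith_weight two_cycles_graph (two_cycles_weight \<alpha> \<beta>) S2 (Suc 0) = 1"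
  by (auto simp: ith_weight_def le_less)

lemma generators_two_cycles [simp]:
  "Vert v \<in> generators two_cycles_graph (two_cycles_weight \<alpha> \<beta>)"
  "Q v i \<in> generators two_cycles_graph (two_cycles_weight \<alpha> \<beta>)
     \<longleftrightarrow> v = U \<and> i = 1 \<and> \<alpha> \<noteq> \<beta>"
  by (cases v; auto simp: generators_def)+

lemma range_sum_two_cycles:
  "\<alpha> < \<beta> \<Longrightarrow> range_sum two_cycles_graph (two_cycles_weight \<alpha> \<beta>) U \<alpha> = {#Vert S1#}"
  "\<alpha> < \<beta> \<Longrightarrow> range_sum two_cycles_graph (two_cycles_weight \<alpha> \<beta>) U \<beta> = {#Vert S2#}"
  "range_sum two_cycles_graph (two_cycles_weight \<alpha> \<alpha>) U \<alpha> = {#Vert S1, Vert S2#}"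
  "range_sum two_cycles_graph (two_cycles_weight \<alpha> \<beta>) S1 (Suc 0) = {#Vert U#}"
  "range_sum two_cycles_graph (two_cycles_weight \<alpha> \<beta>) S2 (Suc 0) = {#Vert U#}"
proof -
  have "{e \<in> {E1, E2}. two_cycles_weight \<alpha> \<beta> e = \<alpha>} = {E1}"
    and "{e \<in> {E1, E2}. two_cycles_weight \<alpha> \<beta> e = \<beta>} = {E2}" if "\<alpha> < \<beta>"
    using that by auto
  then show "\<alpha> < \<beta> \<Longrightarrow> range_sum two_cycles_graph (two_cycles_weight \<alpha> \<beta>) U \<alpha> = {#Vert S1#}"
    and "\<alpha> < \<beta> \<Longrightarrow> range_sum two_cycles_graph (two_cycles_weight \<alpha> \<beta>) U \<beta> = {#Vert S2#}"
    by (simp_all add: range_sum_def)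
  have "{e \<in> {E1, E2}. two_cycles_weight \<alpha> \<alpha> e = \<alpha>} = {E1, E2}"
    and "{e \<in> {F1}. two_cycles_weight \<alpha> \<beta> e = 1} = {F1}"
    and "{e \<in> {F2}. two_cycles_weight \<alpha> \<beta> e = 1} = {F2}"
    by auto
  then show "range_sum two_cycles_graph (two_cycles_weight \<alpha> \<alpha>) U \<alpha> = {#Vert S1, Vert S2#}"
    and "range_sum two_cycles_graph (two_cycles_weight \<alpha> \<beta>) S1 (Suc 0) = {#Vert U#}"
    and "range_sum two_cycles_graph (two_cycles_weight \<alpha> \<beta>) S2 (Suc 0) = {#Vert U#}"
    by (simp_all add: range_sum_def)
qed

lemmas tc_data = ith_weight_two_cycles range_sum_two_cycles q_elem_def

text \<open>
  The case names used from here on: \<open>lower\<close> and \<open>upper\<close> are the reductions of \<open>u\<close> for its smaller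
  and its larger weight, \<open>merged\<close> is the one that replaces them when the weights agree, and
  \<open>cycle\<close> leads from \<open>s\<^sub>1\<close> or \<open>s\<^sub>2\<close> back to \<open>u\<close>.
\<close>

lemma tc_red_cases [consumes 2, case_names merged lower upper cycle]:
  assumes red: "tc_red \<alpha> \<beta> a b" and le: "\<alpha> \<le> \<beta>"
  obtains
    (merged) y where "\<alpha> = \<beta>" "y \<in> tc_free \<alpha> \<beta>"
      "a = y + replicate_mset \<alpha> (Vert U)" "b = y + {#Vert S1, Vert S2#}"
  | (lower) y where "\<alpha> < \<beta>" "y \<in> tc_free \<alpha> \<beta>"
      "a = y + replicate_mset \<alpha> (Vert U)" "b = y + {#Q U 1, Vert S1#}"
  | (upper) y where "\<alpha> < \<beta>" "y \<in> tc_free \<alpha> \<beta>"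
      "a = y + {#Q U 1#} + replicate_mset (\<beta> - \<alpha>) (Vert U)" "b = y + {#Vert S2#}"
  | (cycle) y s where "s \<in> {S1, S2}" "y \<in> tc_free \<alpha> \<beta>"
      "a = y + {#Vert s#}" "b = y + {#Vert U#}"
  using red
proof cases
  case (1 y u i)
  note out = 1(1,2) and y = 1(3) and i = 1(5,6)
  show ?thesis
  proof (cases u)
    case U
    have "i = 1 \<or> i = 2 \<and> \<alpha> \<noteq> \<beta>"
      using i U by (auto split: if_splits)
    then show ?thesis
    proof
      assume "i = 1"
      then show ?thesis
      proof (cases "\<alpha> = \<beta>")
        case True
        then show ?thesis using out y U \<open>i = 1\<close> by (intro merged[of y]) (auto simp: tc_data)
      next
        case False
        then show ?thesis
          using le out y U \<open>i = 1\<close> by (intro lower[of y]) (auto simp: tc_data)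
      qed
    next
      assume "i = 2 \<and> \<alpha> \<noteq> \<beta>"
      then show ?thesis using le out y U by (intro upper[of y]) (auto simp: tc_data)
    qed
  next
    case S1
    then show ?thesis using out y i by (intro cycle[of S1 y]) (auto simp: tc_data le_Suc_eq)
  next
    case S2
    then show ?thesis using out y i by (intro cycle[of S2 y]) (auto simp: tc_data le_Suc_eq)
  qed
qed

lemma tc_red_merged:
  assumes "y \<in> tc_free \<alpha> \<alpha>"
  shows "tc_red \<alpha> \<alpha> (y + replicate_mset \<alpha> (Vert U)) (y + {#Vert S1, Vert S2#})"
  using wg_red.intros[OF assms, of U 1] by (simp add: tc_data)

lemma tc_red_lower:
  assumes "\<alpha> < \<beta>" "y \<in> tc_free \<alpha> \<beta>"
  shows "tc_red \<alpha> \<beta> (y + replicate_mset \<alpha> (Vert U)) (y + {#Q U 1, Vert S1#})"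
  using wg_red.intros[OF assms(2), of U 1] assms(1) by (simp add: tc_data add_mset_commute)

lemma tc_red_upper:
  assumes "\<alpha> < \<beta>" "y \<in> tc_free \<alpha> \<beta>"
  shows "tc_red \<alpha> \<beta> (y + {#Q U 1#} + replicate_mset (\<beta> - \<alpha>) (Vert U)) (y + {#Vert S2#})"
  using wg_red.intros[OF assms(2), of U 2] assms(1) by (simp add: tc_data)

lemma tc_red_cycle:
  assumes "y \<in> tc_free \<alpha> \<beta>" "s \<in> {S1, S2}"
  shows "tc_red \<alpha> \<beta> (y + {#Vert s#}) (y + {#Vert U#})"
  using wg_red.intros[OF assms(1), of s 1] assms(2) by (auto simp: tc_data)

lemma tc_red_free:
  assumes "tc_red \<alpha> \<beta> a b" "\<alpha> \<le> \<beta>"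
  shows "a \<in> tc_free \<alpha> \<beta> \<and> b \<in> tc_free \<alpha> \<beta>"
  using assms by (cases rule: tc_red_cases) auto

lemma tc_reds_free:
  assumes "(tc_red \<alpha> \<beta>)\<^sup>*\<^sup>* a b" "a \<in> tc_free \<alpha> \<beta>" "\<alpha> \<le> \<beta>"
  shows "b \<in> tc_free \<alpha> \<beta>"
  using assms by (induction rule: rtranclp_induct) (auto dest: tc_red_free)

section \<open>Passage to two counters\<close>

text \<open>
  The constants \<open>1\<close> and \<open>2\<close> added to \<open>k\<close> on the right are the numbers of edges of \<open>u\<close> involved: each
  contributes its range, here no longer distinguished from \<open>u\<close>.
\<close>

inductive count_step :: "nat \<Rightarrow> nat \<Rightarrow> nat \<times> nat \<Rightarrow> nat \<times> nat \<Rightarrow> bool" for \<alpha> \<beta> where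
  merged: "\<alpha> = \<beta> \<Longrightarrow> count_step \<alpha> \<beta> (k + \<alpha>, n) (k + 2, n)"
| lower: "\<alpha> < \<beta> \<Longrightarrow> count_step \<alpha> \<beta> (k + \<alpha>, n) (k + 1, n + 1)"
| upper: "\<alpha> < \<beta> \<Longrightarrow> count_step \<alpha> \<beta> (k + (\<beta> - \<alpha>), n + 1) (k + 1, n)"

definition counts :: "two_cycles_vertex generator multiset \<Rightarrow> nat \<times> nat" where
  "counts a = (count a (Vert U) + count a (Vert S1) + count a (Vert S2), count a (Q U 1))"

definition from_counts :: "nat \<times> nat \<Rightarrow> two_cycles_vertex generator multiset" where
  "from_counts p = replicate_mset (fst p) (Vert U) + replicate_mset (snd p) (Q U 1)"

lemma counts_tc_red:
  assumes "tc_red \<alpha> \<beta> a b" "\<alpha> \<le> \<beta>"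
  shows "counts a = counts b \<or> count_step \<alpha> \<beta> (counts a) (counts b)"
  using assms
proof (cases rule: tc_red_cases)
  case (merged y)
  then have "counts a = (fst (counts y) + \<alpha>, snd (counts y))"
    "counts b = (fst (counts y) + 2, snd (counts y))"
    by (auto simp: counts_def)
  then show ?thesis using count_step.merged[OF merged(1)] by simp
next
  case (lower y)
  then have "counts a = (fst (counts y) + \<alpha>, snd (counts y))"
    "counts b = (fst (counts y) + 1, snd (counts y) + 1)"
    by (auto simp: counts_def)
  then show ?thesis using count_step.lower[OF lower(1)] by simp
next
  case (upper y)
  then have "counts a = (fst (counts y) + (\<beta> - \<alpha>), snd (counts y) + 1)"
    "counts b = (fst (counts y) + 1, snd (counts y))"
    by (auto simp: counts_def)
  then show ?thesis using count_step.upper[OF upper(1)] by simp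
next
  case (cycle y s)
  then show ?thesis by (auto simp: counts_def)
qed

text \<open>
  Converting all \<open>s\<^sub>1\<close> and \<open>s\<^sub>2\<close> to \<open>u\<close> gives every element a reduct that depends on its counts
  only; this is what makes joins of pairs liftable to joins of monoid elements.
\<close>

lemma tc_reds_from_counts:
  assumes "a \<in> tc_free \<alpha> \<beta>"
  shows "(tc_red \<alpha> \<beta>)\<^sup>*\<^sup>* a (from_counts (counts a))"
  using assms
proof (induction "count a (Vert S1) + count a (Vert S2)" arbitrary: a)
  case 0
  have "a = from_counts (counts a)"
  proof (rule multiset_eqI)
    fix x
    show "count a x = count (from_counts (counts a)) x"
    proof (cases x)
      case (Vert v)
      then show ?thesis using 0(1) by (cases v) (auto simp: counts_def from_counts_def)
    next
      case (Q v i)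
      show ?thesis
      proof (cases "v = U \<and> i = 1")
        case False
        then have "x \<notin># a" using 0(2) Q by (auto simp: free_monoid_def)
        then show ?thesis using Q False
          by (auto simp: from_counts_def counts_def not_in_iff)
      qed (auto simp: Q counts_def from_counts_def)
    qed
  qed
  then show ?case by simp
next
  case (Suc k)
  then obtain s where s: "s \<in> {S1, S2}" "Vert s \<in># a"
    by (metis add_is_0 insertCI nat.distinct(1) not_in_iff)
  then obtain y where a: "a = y + {#Vert s#}" by (metis add_mset_add_single mset_add)
  let ?b = "y + {#Vert U#}"
  have red: "tc_red \<alpha> \<beta> a ?b"
    using tc_red_cycle s(1) Suc.prems a by auto
  have "(tc_red \<alpha> \<beta>)\<^sup>*\<^sup>* ?b (from_counts (counts ?b))"
    using Suc.hyps(2) Suc.prems s(1) by (intro Suc.hyps(1)) (auto simp: a)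
  moreover have "counts ?b = counts a"
    using s(1) by (auto simp: a counts_def)
  ultimately show ?case using red by (metis converse_rtranclp_into_rtranclp)
qed

text \<open>
  The target \<open>from_counts p'\<close> is reached by the corresponding reduction of \<open>u\<close>, followed by
  conversion of the new \<open>s\<^sub>1\<close> or \<open>s\<^sub>2\<close>.  The hypothesis on \<open>from_counts p\<close> excludes symbols
  \<open>q\<close> in the case \<open>\<alpha> = \<beta>\<close>, where they are not generators.
\<close>

lemma tc_reds_count_step:
  assumes step: "count_step \<alpha> \<beta> p p'" and free: "from_counts p \<in> tc_free \<alpha> \<beta>"
    and le: "\<alpha> \<le> \<beta>"
  shows "(tc_red \<alpha> \<beta>)\<^sup>*\<^sup>* (from_counts p) (from_counts p')"
proof -
  have "\<exists>b. tc_red \<alpha> \<beta> (from_counts p) b \<and> counts b = p'"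
    using step
  proof cases
    case (merged k n)
    let ?y = "from_counts (k, n)"
    have "?y \<in> tc_free \<alpha> \<beta>" using free merged by (auto simp: from_counts_def)
    then have "tc_red \<alpha> \<beta> (?y + replicate_mset \<alpha> (Vert U)) (?y + {#Vert S1, Vert S2#})"
      using tc_red_merged merged(3) by simp
    moreover have "?y + replicate_mset \<alpha> (Vert U) = from_counts p"
      by (rule multiset_eqI) (auto simp: merged from_counts_def)
    ultimately have "tc_red \<alpha> \<beta> (from_counts p) (?y + {#Vert S1, Vert S2#})" by (simp only:)
    moreover have "counts (?y + {#Vert S1, Vert S2#}) = p'"
      by (simp add: merged counts_def from_counts_def)
    ultimately show ?thesis by blast
  next
    case (lower k n)
    let ?y = "from_counts (k, n)"
    have "?y \<in> tc_free \<alpha> \<beta>" using free lower by (auto simp: from_counts_def)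
    then have "tc_red \<alpha> \<beta> (?y + replicate_mset \<alpha> (Vert U)) (?y + {#Q U 1, Vert S1#})"
      using tc_red_lower lower(3) by blast
    moreover have "?y + replicate_mset \<alpha> (Vert U) = from_counts p"
      by (rule multiset_eqI) (auto simp: lower from_counts_def)
    ultimately have "tc_red \<alpha> \<beta> (from_counts p) (?y + {#Q U 1, Vert S1#})" by (simp only:)
    moreover have "counts (?y + {#Q U 1, Vert S1#}) = p'"
      by (simp add: lower counts_def from_counts_def)
    ultimately show ?thesis by blast
  next
    case (upper k n)
    let ?y = "from_counts (k, n)"
    have "?y \<in> tc_free \<alpha> \<beta>" using free upper by (auto simp: from_counts_def)
    then have "tc_red \<alpha> \<beta> (?y + {#Q U 1#} + replicate_mset (\<beta> - \<alpha>) (Vert U)) (?y + {#Vert S2#})"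
      using tc_red_upper upper(3) by blast
    moreover have "?y + {#Q U 1#} + replicate_mset (\<beta> - \<alpha>) (Vert U) = from_counts p"
      by (rule multiset_eqI) (auto simp: upper from_counts_def)
    ultimately have "tc_red \<alpha> \<beta> (from_counts p) (?y + {#Vert S2#})" by (simp only:)
    moreover have "counts (?y + {#Vert S2#}) = p'"
      by (simp add: upper counts_def from_counts_def)
    ultimately show ?thesis by blast
  qed
  then obtain b where b: "tc_red \<alpha> \<beta> (from_counts p) b" "counts b = p'" by blast
  moreover have "(tc_red \<alpha> \<beta>)\<^sup>*\<^sup>* b (from_counts p')"
    using tc_reds_from_counts[of b] tc_red_free[OF b(1) le] b(2) by simp
  ultimately show ?thesis by (meson converse_rtranclp_into_rtranclp)
qed

lemma tc_reds_count_steps: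
  assumes "(count_step \<alpha> \<beta>)\<^sup>*\<^sup>* p p'" "from_counts p \<in> tc_free \<alpha> \<beta>" "\<alpha> \<le> \<beta>"
  shows "(tc_red \<alpha> \<beta>)\<^sup>*\<^sup>* (from_counts p) (from_counts p')"
  using assms
proof (induction rule: rtranclp_induct)
  case (step p' p'')
  then show ?case
    by (meson rtranclp_trans tc_reds_count_step tc_reds_free)
qed simp

text \<open>
  A reduction either preserves the counts or performs a step on them, so equivalent elements have
  counts with equal invariant; a join of these counts lifts back through \<open>from_counts\<close>.
\<close>

lemma confluent_if_count_invariant:
  fixes f :: "nat \<times> nat \<Rightarrow> 'b"
  assumes le: "\<alpha> \<le> \<beta>"
    and inv: "\<And>p p'. count_step \<alpha> \<beta> p p' \<Longrightarrow> f p = f p'"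
    and join: "\<And>p p'. f p = f p' \<Longrightarrow>
                 \<exists>r. (count_step \<alpha> \<beta>)\<^sup>*\<^sup>* p r \<and> (count_step \<alpha> \<beta>)\<^sup>*\<^sup>* p' r"
  shows "wg_monoid_confluent two_cycles_graph (two_cycles_weight \<alpha> \<beta>)"
  unfolding wg_monoid_confluent_def
proof (intro ballI iffI)
  fix a b
  assume free: "a \<in> tc_free \<alpha> \<beta>" "b \<in> tc_free \<alpha> \<beta>"
    and cong: "wg_cong two_cycles_graph (two_cycles_weight \<alpha> \<beta>) a b"
  have "f (counts c) = f (counts d)" if "tc_red \<alpha> \<beta> c d" for c d
    using counts_tc_red[OF that le] inv by metis
  then have "f (counts a) = f (counts b)"
    using wg_cong_invariant[where f = "\<lambda>a. f (counts a)", OF _ cong] tc_red_free[OF _ le] by blast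
  then obtain r where r: "(count_step \<alpha> \<beta>)\<^sup>*\<^sup>* (counts a) r" "(count_step \<alpha> \<beta>)\<^sup>*\<^sup>* (counts b) r"
    using join by blast
  have "(tc_red \<alpha> \<beta>)\<^sup>*\<^sup>* c (from_counts r)"
    if "c \<in> tc_free \<alpha> \<beta>" "(count_step \<alpha> \<beta>)\<^sup>*\<^sup>* (counts c) r" for c
    using that tc_reds_from_counts[of c] tc_reds_count_steps le
    by (meson rtranclp_trans tc_reds_free)
  then show "\<exists>c\<in>tc_free \<alpha> \<beta>. (tc_red \<alpha> \<beta>)\<^sup>*\<^sup>* a c \<and> (tc_red \<alpha> \<beta>)\<^sup>*\<^sup>* b c"
    using free r tc_reds_free[OF _ free(1) le] by blast
next
  fix a b
  assume "a \<in> tc_free \<alpha> \<beta>" "b \<in> tc_free \<alpha> \<beta>"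
    and "\<exists>c\<in>tc_free \<alpha> \<beta>. (tc_red \<alpha> \<beta>)\<^sup>*\<^sup>* a c \<and> (tc_red \<alpha> \<beta>)\<^sup>*\<^sup>* b c"
  then show "wg_cong two_cycles_graph (two_cycles_weight \<alpha> \<beta>) a b"
    by (meson wg_reds_imp_wg_cong wg_cong.sym wg_cong.trans)
qed

section \<open>The confluent cases\<close>

lemma confluent_both_one: "wg_monoid_confluent two_cycles_graph (two_cycles_weight 1 1)"
proof (rule confluent_if_count_invariant)
  let ?f = "\<lambda>p::nat \<times> nat. (fst p = 0, snd p)"
  show "?f p = ?f p'" if "count_step 1 1 p p'" for p p'
    using that by cases auto
  have grow: "(count_step 1 1)\<^sup>*\<^sup>* (Suc k, n) (Suc (k + j), n)" for k j n
  proof (induction j)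
    case (Suc j)
    have "count_step 1 1 (k + j + 1, n) (k + j + 2, n)" by (rule merged) simp
    with Suc show ?case by (simp add: rtranclp.rtrancl_into_rtrancl)
  qed simp
  show "\<exists>r. (count_step 1 1)\<^sup>*\<^sup>* p r \<and> (count_step 1 1)\<^sup>*\<^sup>* p' r" if f: "?f p = ?f p'" for p p'
  proof (cases "fst p = 0")
    case True
    then have "p = p'" using f by (auto simp: prod_eq_iff)
    then show ?thesis by blast
  next
    case False
    then obtain k l n where "p = (Suc k, n)" "p' = (Suc l, n)"
      using f by (cases p, cases p') (auto dest!: gr0_implies_Suc)
    then show ?thesis using grow[of k n l] grow[of l n k]
      by (auto simp: add.commute)
  qed
qed simp

text \<open>
  A step lowers \<open>v\<close> by \<open>\<alpha> - 2\<close> and ends at \<open>v \<ge> 2\<close>.  Hence \<open>v \<le> 1\<close> is isolated, while every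
  \<open>v \<ge> 2\<close> reduces to the smallest number \<open>\<ge> 2\<close> in its residue class.  For \<open>\<alpha> = 2\<close> steps change
  nothing, in accordance with \<open>m mod 0 = m\<close>.
\<close>

lemma confluent_equal_weights:
  assumes "2 \<le> \<alpha>"
  shows "wg_monoid_confluent two_cycles_graph (two_cycles_weight \<alpha> \<alpha>)"
proof (rule confluent_if_count_invariant)
  let ?c = "\<lambda>v. if v \<le> 1 then v else 2 + (v - 2) mod (\<alpha> - 2)"
  let ?f = "\<lambda>p::nat \<times> nat. (?c (fst p), snd p)"
  show "?f p = ?f p'" if "count_step \<alpha> \<alpha> p p'" for p p'
    using that
  proof cases
    case (merged k n)
    have "k + \<alpha> - 2 = k + (\<alpha> - 2)" using assms by simp
    then have "(k + \<alpha> - 2) mod (\<alpha> - 2) = k mod (\<alpha> - 2)"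
      by (simp only: mod_add_self2)
    then show ?thesis using merged assms by simp
  qed auto
  have normal: "(count_step \<alpha> \<alpha>)\<^sup>*\<^sup>* (v, n) (?c v, n)" for v n
  proof (induction v rule: less_induct)
    case (less v)
    show ?case
    proof (cases "\<alpha> \<le> v \<and> 3 \<le> \<alpha>")
      case True
      let ?v = "v - \<alpha> + 2"
      have "count_step \<alpha> \<alpha> (v - \<alpha> + \<alpha>, n) (?v, n)" by (rule merged) simp
      then have "count_step \<alpha> \<alpha> (v, n) (?v, n)" using True by simp
      moreover have "(count_step \<alpha> \<alpha>)\<^sup>*\<^sup>* (?v, n) (?c ?v, n)"
        using less.IH[of ?v] True by linarith
      ultimately have "(count_step \<alpha> \<alpha>)\<^sup>*\<^sup>* (v, n) (?c ?v, n)"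
        by (rule converse_rtranclp_into_rtranclp)
      moreover have "?c ?v = ?c v"
      proof -
        have "v - 2 - (\<alpha> - 2) = v - \<alpha>" using True by linarith
        then have "(v - 2) mod (\<alpha> - 2) = (v - \<alpha>) mod (\<alpha> - 2)"
          using True le_mod_geq[of "\<alpha> - 2" "v - 2"] by (metis diff_le_mono)
        then show ?thesis using True by simp
      qed
      ultimately show ?thesis by (simp only:)
    next
      case False
      then have "?c v = v" using assms by auto
      then show ?thesis by simp
    qed
  qed
  show "\<exists>r. (count_step \<alpha> \<alpha>)\<^sup>*\<^sup>* p r \<and> (count_step \<alpha> \<alpha>)\<^sup>*\<^sup>* p' r" if f: "?f p = ?f p'" for p p'
  proof (intro exI conjI)
    show "(count_step \<alpha> \<alpha>)\<^sup>*\<^sup>* p (?f p)"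
      using normal[of "fst p" "snd p"] by (simp only: prod.collapse)
    show "(count_step \<alpha> \<alpha>)\<^sup>*\<^sup>* p' (?f p)"
      unfolding f using normal[of "fst p'" "snd p'"] by (simp only: prod.collapse)
  qed
qed simp

text \<open>
  The invariant for both families of confluent pairs \<open>\<alpha> < \<beta>\<close>.  Pairs without vertices are
  irreducible and form singleton classes.  For \<open>\<beta> = 2\<close> the convention \<open>m mod 0 = m\<close> keeps the
  number of vertices, as it should: then neither step changes it.
\<close>

definition count_class :: "nat \<Rightarrow> nat \<times> nat \<Rightarrow> nat \<times> nat" where
  "count_class \<beta> p = (if fst p = 0 then p else ((fst p - 1) mod (\<beta> - 2) + 1, 0))"

lemma count_class_step:
  assumes "count_step \<alpha> \<beta> p p'" "1 \<le> \<alpha>" "\<alpha> < \<beta>" "\<alpha> = 1 \<or> \<beta> = \<alpha> + 1"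
  shows "count_class \<beta> p = count_class \<beta> p'"
  using assms(1)
proof cases
  case (lower k n)
  have "(k + \<alpha> - 1) mod (\<beta> - 2) = k mod (\<beta> - 2)"
    using assms(2,4) by (cases \<alpha>) auto
  then show ?thesis using lower assms(2) by (simp add: count_class_def)
next
  case (upper k n)
  have "(k + (\<beta> - \<alpha>) - 1) mod (\<beta> - 2) = k mod (\<beta> - 2)"
  proof (cases "\<alpha> = 1")
    case True
    then have "k + (\<beta> - \<alpha>) - 1 = k + (\<beta> - 2)" using assms(3) by simp
    then show ?thesis by simp
  qed (use assms(4) in auto)
  then show ?thesis using upper by (simp add: count_class_def)
qed (use assms(3) in simp)

text \<open>
  Lowering \<open>v\<close> costs a symbol \<open>q\<close>, which is created just before it is spent.  Normalising \<open>v\<close> leaves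
  different counts of \<open>q\<close>; these are equalised upwards.
\<close>

lemma confluent_lower_one:
  assumes "1 < \<beta>"
  shows "wg_monoid_confluent two_cycles_graph (two_cycles_weight 1 \<beta>)"
proof (rule confluent_if_count_invariant[where f = "count_class \<beta>"])
  show "count_class \<beta> p = count_class \<beta> p'" if "count_step 1 \<beta> p p'" for p p'
    using count_class_step[OF that] assms by simp
  have more: "(count_step 1 \<beta>)\<^sup>*\<^sup>* (Suc k, n) (Suc k, n + j)" for k n j
  proof (induction j)
    case (Suc j)
    have "count_step 1 \<beta> (k + 1, n + j) (k + 1, n + j + 1)" by (rule lower) (rule assms)
    with Suc show ?case by (simp add: rtranclp.rtrancl_into_rtrancl)
  qed simp
  have normal: "(count_step 1 \<beta>)\<^sup>*\<^sup>* (Suc k, n) (Suc (k mod (\<beta> - 2)), n)" for k n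
  proof (induction k rule: less_induct)
    case (less k)
    show ?case
    proof (cases "\<beta> - 2 \<le> k \<and> 2 < \<beta>")
      case True
      let ?k = "k - (\<beta> - 2)"
      have "count_step 1 \<beta> (?k + (\<beta> - 1), n + 1) (?k + 1, n)" by (rule upper) (rule assms)
      moreover have "?k + (\<beta> - 1) = Suc k" "?k + 1 = Suc ?k" using True by auto
      ultimately have "count_step 1 \<beta> (Suc k, n + 1) (Suc ?k, n)" by (simp only:)
      with more have "(count_step 1 \<beta>)\<^sup>*\<^sup>* (Suc k, n) (Suc ?k, n)"
        by (rule rtranclp.rtrancl_into_rtrancl)
      moreover have "(count_step 1 \<beta>)\<^sup>*\<^sup>* (Suc ?k, n) (Suc (?k mod (\<beta> - 2)), n)"
        using less.IH[of ?k] True by linarith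
      ultimately have "(count_step 1 \<beta>)\<^sup>*\<^sup>* (Suc k, n) (Suc (?k mod (\<beta> - 2)), n)"
        by (rule rtranclp_trans)
      moreover have "?k mod (\<beta> - 2) = k mod (\<beta> - 2)"
        using True le_mod_geq by simp
      ultimately show ?thesis by (simp only:)
    next
      case False
      then have "k mod (\<beta> - 2) = k" using assms by auto
      then show ?thesis by simp
    qed
  qed
  show "\<exists>r. (count_step 1 \<beta>)\<^sup>*\<^sup>* p r \<and> (count_step 1 \<beta>)\<^sup>*\<^sup>* p' r"
    if f: "count_class \<beta> p = count_class \<beta> p'" for p p'
  proof (cases "fst p = 0 \<or> fst p' = 0")
    case True
    then have "p = p'" using f by (auto simp: count_class_def split: if_splits)
    then show ?thesis by blast
  next
    case False
    then obtain k n l j where p: "p = (Suc k, n)" "p' = (Suc l, j)"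
      by (cases p, cases p') (auto dest!: gr0_implies_Suc)
    have "k mod (\<beta> - 2) = l mod (\<beta> - 2)"
      using f p by (simp add: count_class_def)
    then have "(count_step 1 \<beta>)\<^sup>*\<^sup>* p (Suc (k mod (\<beta> - 2)), n + j)"
      "(count_step 1 \<beta>)\<^sup>*\<^sup>* p' (Suc (k mod (\<beta> - 2)), n + j)"
      using p normal[of k n] normal[of l j] more[of "k mod (\<beta> - 2)" n j]
        more[of "k mod (\<beta> - 2)" j n]
      by (simp_all add: add.commute)
    then show ?thesis by blast
  qed
qed (use assms in simp)

text \<open>
  Here lowering \<open>v\<close> produces a symbol \<open>q\<close>, which is destroyed at once, so that the representative
  of a class in \<open>count_class\<close> is itself a reduct of every member.
\<close>

lemma confluent_consecutive:
  assumes "1 \<le> \<alpha>"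
  shows "wg_monoid_confluent two_cycles_graph (two_cycles_weight \<alpha> (\<alpha> + 1))"
proof (rule confluent_if_count_invariant[where f = "count_class (\<alpha> + 1)"])
  let ?S = "count_step \<alpha> (\<alpha> + 1)"
  show "count_class (\<alpha> + 1) p = count_class (\<alpha> + 1) p'" if "?S p p'" for p p'
    using count_class_step[OF that] assms by simp
  have drop: "?S (Suc k, Suc n) (Suc k, n)" for k n
    using upper[of \<alpha> "\<alpha> + 1" k n] by simp
  have drop_all: "?S\<^sup>*\<^sup>* (Suc k, n) (Suc k, 0)" for k n
  proof (induction n)
    case (Suc n)
    then show ?case using drop by (metis converse_rtranclp_into_rtranclp)
  qed simp
  have normal: "?S\<^sup>*\<^sup>* (Suc k, 0) (Suc (k mod (\<alpha> - 1)), 0)" for k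
  proof (induction k rule: less_induct)
    case (less k)
    show ?case
    proof (cases "\<alpha> - 1 \<le> k \<and> 1 < \<alpha>")
      case True
      let ?k = "k - (\<alpha> - 1)"
      have "?S (?k + \<alpha>, 0) (?k + 1, 0 + 1)" by (rule lower) simp
      moreover have "?k + \<alpha> = Suc k" "?k + 1 = Suc ?k" using True by auto
      ultimately have "?S (Suc k, 0) (Suc ?k, Suc 0)" by (simp only: One_nat_def add_0)
      then have "?S\<^sup>*\<^sup>* (Suc k, 0) (Suc ?k, 0)"
        using drop by (rule rtranclp.rtrancl_into_rtrancl[OF r_into_rtranclp])
      moreover have "?S\<^sup>*\<^sup>* (Suc ?k, 0) (Suc (?k mod (\<alpha> - 1)), 0)"
        using less.IH[of ?k] True by linarith
      ultimately have "?S\<^sup>*\<^sup>* (Suc k, 0) (Suc (?k mod (\<alpha> - 1)), 0)"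
        by (rule rtranclp_trans)
      moreover have "?k mod (\<alpha> - 1) = k mod (\<alpha> - 1)"
        using True le_mod_geq by simp
      ultimately show ?thesis by (simp only:)
    next
      case False
      then have "k mod (\<alpha> - 1) = k" using assms by auto
      then show ?thesis by simp
    qed
  qed
  have to_class: "?S\<^sup>*\<^sup>* p (count_class (\<alpha> + 1) p)" for p
  proof (cases "fst p = 0")
    case False
    then obtain k n where "p = (Suc k, n)" by (cases p) (auto dest!: gr0_implies_Suc)
    then show ?thesis
      using rtranclp_trans[OF drop_all normal] by (simp add: count_class_def)
  qed (simp add: count_class_def)
  show "\<exists>r. ?S\<^sup>*\<^sup>* p r \<and> ?S\<^sup>*\<^sup>* p' r"
    if "count_class (\<alpha> + 1) p = count_class (\<alpha> + 1) p'" for p p'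
    using to_class[of p] to_class[of p'] that by metis
qed simp

section \<open>The obstruction to confluence\<close>

lemma tc_reds_counts_closed:
  assumes "(tc_red \<alpha> \<beta>)\<^sup>*\<^sup>* a b" "\<alpha> \<le> \<beta>" "counts a \<in> X"
    and "\<And>p p'. count_step \<alpha> \<beta> p p' \<Longrightarrow> p \<in> X \<Longrightarrow> p' \<in> X"
  shows "counts b \<in> X"
  using assms(1,3)
  by (induction rule: rtranclp_induct) (metis counts_tc_red assms(2,4))+

text \<open>
  The overlap of the two reductions of \<open>u\<close> gives two equivalent elements lying in disjoint sets of
  counts, both closed under steps: with fewer than \<open>\<beta> - \<alpha>\<close> vertices only \<open>lower\<close> can apply, and
  with fewer than \<open>\<alpha>\<close> vertices and no \<open>q\<close> nothing can.
\<close>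

lemma not_confluent:
  assumes "2 \<le> \<alpha>" "\<alpha> + 2 \<le> \<beta>"
  shows "\<not> wg_monoid_confluent two_cycles_graph (two_cycles_weight \<alpha> \<beta>)"
proof
  assume conf: "wg_monoid_confluent two_cycles_graph (two_cycles_weight \<alpha> \<beta>)"
  have less: "\<alpha> < \<beta>" using assms by simp
  (* The smallest number of copies of u that lets both reductions apply. *)
  define M where "M = max \<alpha> (\<beta> - \<alpha>)"
  let ?p = "from_counts (M, 1)"
  let ?y = "from_counts (M - \<alpha>, 1)" and ?z = "from_counts (M - (\<beta> - \<alpha>), 0)"
  let ?a = "?y + {#Q U 1, Vert S1#}" and ?b = "?z + {#Vert S2#}"
  have free: "?y \<in> tc_free \<alpha> \<beta>" "?z \<in> tc_free \<alpha> \<beta>"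
    using less by (auto simp: from_counts_def)
  have "?y + replicate_mset \<alpha> (Vert U) = ?p"
    and "?z + {#Q U 1#} + replicate_mset (\<beta> - \<alpha>) (Vert U) = ?p"
    by (auto intro!: multiset_eqI simp: from_counts_def M_def)
  then have "tc_red \<alpha> \<beta> ?p ?a" "tc_red \<alpha> \<beta> ?p ?b"
    using tc_red_lower[OF less free(1)] tc_red_upper[OF less free(2)] by simp_all
  then have "wg_cong two_cycles_graph (two_cycles_weight \<alpha> \<beta>) ?a ?b"
    by (meson wg_cong.red wg_cong.sym wg_cong.trans)
  then obtain c where c: "(tc_red \<alpha> \<beta>)\<^sup>*\<^sup>* ?a c" "(tc_red \<alpha> \<beta>)\<^sup>*\<^sup>* ?b c"
    using conf free less by (auto simp: wg_monoid_confluent_def)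
  have "counts c \<in> {(v, n). v < \<beta> - \<alpha> \<and> 2 \<le> n}"
  proof (rule tc_reds_counts_closed[OF c(1)])
    show "counts ?a \<in> {(v, n). v < \<beta> - \<alpha> \<and> 2 \<le> n}"
      using assms by (auto simp: counts_def from_counts_def M_def)
    show "p' \<in> {(v, n). v < \<beta> - \<alpha> \<and> 2 \<le> n}"
      if "count_step \<alpha> \<beta> p p'" "p \<in> {(v, n). v < \<beta> - \<alpha> \<and> 2 \<le> n}" for p p'
      using that assms by cases auto
  qed (use less in simp)
  moreover have "counts c \<in> {(v, n). v < \<alpha> \<and> n = 0}"
  proof (rule tc_reds_counts_closed[OF c(2)])
    show "counts ?b \<in> {(v, n). v < \<alpha> \<and> n = 0}"
      using assms by (auto simp: counts_def from_counts_def M_def)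
    show "p' \<in> {(v, n). v < \<alpha> \<and> n = 0}"
      if "count_step \<alpha> \<beta> p p'" "p \<in> {(v, n). v < \<alpha> \<and> n = 0}" for p p'
      using that assms by cases auto
  qed (use less in simp)
  ultimately show False by auto
qed

theorem proposition3p27:
  fixes \<alpha> \<beta> :: nat
  assumes "1 \<le> \<alpha>" and "\<alpha> \<le> \<beta>"
  shows "wg_monoid_confluent two_cycles_graph (two_cycles_weight \<alpha> \<beta>)
           \<longleftrightarrow> \<alpha> = 1 \<or> \<beta> - \<alpha> \<le> 1"
proof
  assume "wg_monoid_confluent two_cycles_graph (two_cycles_weight \<alpha> \<beta>)"
  then show "\<alpha> = 1 \<or> \<beta> - \<alpha> \<le> 1"
    using not_confluent[of \<alpha> \<beta>] assms by linarith
next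
  assume "\<alpha> = 1 \<or> \<beta> - \<alpha> \<le> 1"
  then consider "\<alpha> = 1" "\<beta> = 1" | "2 \<le> \<alpha>" "\<beta> = \<alpha>" | "\<alpha> = 1" "1 < \<beta>" | "\<beta> = \<alpha> + 1"
    using assms by linarith
  then show "wg_monoid_confluent two_cycles_graph (two_cycles_weight \<alpha> \<beta>)"
    using confluent_both_one confluent_equal_weights confluent_lower_one
      confluent_consecutive assms(1)
    by cases simp_all
qed

end
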